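(* Fix $\delta>0$. Let $\boldsymbol q_t^{\mu,\delta}$ be the solution of $$\mu\ddot{\boldsymbol q}_t^{\mu,\delta}=\boldsymbol b(\boldsymbol q_t^{\mu,\delta})-\lambda(\boldsymbol q_t^{\mu,\delta})\dot{\boldsymbol q}_t^{\mu,\delta}+\sigma(\boldsymbol q_t^{\mu,\delta})\dot{\boldsymbol W}_t^\delta,\qquad \boldsymbol q_0^{\mu,\delta}=\boldsymbol q\in\mathbb R^d,\ \dot{\boldsymbol q}_0^{\mu,\delta}=\boldsymbol p\in\mathbb R^d,$$ and let $\widetilde{\boldsymbol q}_t^\delta$ be the unique solution of the equation obtained by putting $\mu=0$, $$\dot{\widetilde{\boldsymbol q}}_t^\delta=\frac{\boldsymbol b(\widetilde{\boldsymbol q}_t^\delta)}{\lambda(\widetilde{\boldsymbol q}_t^\delta)}+\frac{\sigma(\widetilde{\boldsymbol q}_t^\delta)}{\lambda(\widetilde{\boldsymbol q}_t^\delta)}\dot{\boldsymbol W}_t^\delta,\qquad \widetilde{\boldsymbol q}_0^\delta=\boldsymbol q.$$ Then for any $\kappa,T>0$ and any fixed $\boldsymbol p\in\mathbb R^d$, $$\lim_{\mu\downarrow0}\mathbf P\Big(\max_{0\le t\le T}|\boldsymbol q_t^{\mu,\delta}-\widetilde{\boldsymbol q}_t^\delta|_{\mathbb R^d}>\kappa\Big)=0.$$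
   Context: Standing assumptions: the vector field $\boldsymbol b:\mathbb R^d\to\mathbb R^d$ and the $d\times d$ matrix function $\sigma$ are continuously differentiable and bounded together with their first derivatives; the matrix $a(\boldsymbol q)=\sigma(\boldsymbol q)\sigma^*(\boldsymbol q)$ is non-degenerate; the friction coefficient $\lambda:\mathbb R^d\to\mathbb R$ is continuously differentiable with bounded first derivatives and $0<\lambda_0\le\lambda(\cdot)\le\Lambda<\infty$ for constants $\lambda_0,\Lambda$. $\boldsymbol W_t$ is a standard Wiener process in $\mathbb R^d$ and its smooth approximation is $$\boldsymbol W_t^\delta=\frac1\delta\int_0^\infty\boldsymbol W_s\,\rho\Big(\frac{s-t}{\delta}\Big)ds=\frac1\delta\int_0^\delta\boldsymbol W_{s+t}\,\rho\Big(\frac s\delta\Big)ds,$$ where $\rho$ is a $C^\infty$ function with support contained in $[0,1]$ and $\int_0^1\rho(s)\,ds=1$; $\dot{\boldsymbol W}_t^\delta$ is its time derivative. The equations are solved pathwise. $|\cdot|_{\mathbb R^d}$ is the Euclidean norm. *)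

theory Defs
  imports "HOL-Probability.Probability"
begin

definition C1_bounded_derivative :: "('a::real_normed_vector \<Rightarrow> 'b::real_normed_vector) \<Rightarrow> bool" where
  "C1_bounded_derivative f \<longleftrightarrow>
     (\<exists>f' :: 'a \<Rightarrow> 'a \<Rightarrow>\<^sub>L 'b.
        (\<forall>x. (f has_derivative blinfun_apply (f' x)) (at x)) \<and>
        continuous_on UNIV f' \<and> bounded (range f'))"

definition smooth_real :: "(real \<Rightarrow> real) \<Rightarrow> bool" where
  "smooth_real f \<longleftrightarrow> (\<forall>n. (deriv ^^ n) f differentiable_on UNIV)"

text \<open>Time is \<open>real\<close>, restricted to \<open>t \<ge> 0\<close>; values at negative times are unconstrained.
  All paths (not only almost all) are continuous, so that equations driven by the process can be
  solved for every sample point.\<close>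

definition wiener_process :: "'w measure \<Rightarrow> (real \<Rightarrow> 'w \<Rightarrow> real ^ 'd) \<Rightarrow> bool" where
  "wiener_process M W \<longleftrightarrow>
     prob_space M \<and>
     (\<forall>t\<ge>0. W t \<in> borel_measurable M) \<and>
     (AE \<omega> in M. W 0 \<omega> = 0) \<and>
     (\<forall>s t. 0 \<le> s \<and> s < t \<longrightarrow>
        distributed M lborel (\<lambda>\<omega>. W t \<omega> - W s \<omega>)
          (\<lambda>x. ennreal (\<Prod>i\<in>UNIV. normal_density 0 (sqrt (t - s)) (x $ i)))) \<and>
     (\<forall>(n::nat) \<tau>. 0 \<le> \<tau> 0 \<and> (\<forall>i<n. \<tau> i \<le> \<tau> (Suc i)) \<longrightarrow>
        prob_space.indep_vars M (\<lambda>_. borel) (\<lambda>i \<omega>. W (\<tau> (Suc i)) \<omega> - W (\<tau> i) \<omega>) {..<n}) \<and>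
     (\<forall>\<omega>\<in>space M. continuous_on {0..} (\<lambda>t. W t \<omega>))"

definition mollifier :: "(real \<Rightarrow> real) \<Rightarrow> bool" where
  "mollifier \<rho> \<longleftrightarrow>
     smooth_real \<rho> \<and> closure {s. \<rho> s \<noteq> 0} \<subseteq> {0..1} \<and> integral {0..1} \<rho> = 1"

definition mollified_path ::
    "(real \<Rightarrow> real) \<Rightarrow> real \<Rightarrow> (real \<Rightarrow> real ^ 'd) \<Rightarrow> real \<Rightarrow> real ^ 'd" where
  "mollified_path \<rho> \<delta> w t = (1 / \<delta>) *\<^sub>R integral {0..} (\<lambda>s. \<rho> ((s - t) / \<delta>) *\<^sub>R w s)"

definition mollified_noise ::
    "(real \<Rightarrow> real) \<Rightarrow> real \<Rightarrow> (real \<Rightarrow> real ^ 'd) \<Rightarrow> real \<Rightarrow> real ^ 'd" where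
  "mollified_noise \<rho> \<delta> w t = vector_derivative (mollified_path \<rho> \<delta> w) (at t)"

text \<open>Both equations are deterministic, on \<open>[0, \<infinity>)\<close>, with a given forcing \<open>\<xi>\<close>; derivatives at
  \<open>t = 0\<close> are one-sided.\<close>

definition second_order_solution ::
    "(real ^ 'd \<Rightarrow> real ^ 'd) \<Rightarrow> (real ^ 'd \<Rightarrow> real) \<Rightarrow> (real ^ 'd \<Rightarrow> real ^ 'd ^ 'd) \<Rightarrow>
     real \<Rightarrow> (real \<Rightarrow> real ^ 'd) \<Rightarrow> real ^ 'd \<Rightarrow> real ^ 'd \<Rightarrow> (real \<Rightarrow> real ^ 'd) \<Rightarrow> bool" where
  "second_order_solution b lam \<sigma> \<mu> \<xi> q0 p0 x \<longleftrightarrow>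
     (\<exists>v a. x 0 = q0 \<and> v 0 = p0 \<and>
        (\<forall>t\<ge>0. (x has_vector_derivative v t) (at t within {0..}) \<and>
               (v has_vector_derivative a t) (at t within {0..}) \<and>
               \<mu> *\<^sub>R a t = b (x t) - lam (x t) *\<^sub>R v t + \<sigma> (x t) *v \<xi> t))"

definition first_order_solution ::
    "(real ^ 'd \<Rightarrow> real ^ 'd) \<Rightarrow> (real ^ 'd \<Rightarrow> real) \<Rightarrow> (real ^ 'd \<Rightarrow> real ^ 'd ^ 'd) \<Rightarrow>
     (real \<Rightarrow> real ^ 'd) \<Rightarrow> real ^ 'd \<Rightarrow> (real \<Rightarrow> real ^ 'd) \<Rightarrow> bool" where
  "first_order_solution b lam \<sigma> \<xi> q0 x \<longleftrightarrow>
     x 0 = q0 \<and>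
     (\<forall>t\<ge>0. (x has_vector_derivative
               ((1 / lam (x t)) *\<^sub>R b (x t) + ((1 / lam (x t)) *\<^sub>R \<sigma> (x t)) *v \<xi> t))
             (at t within {0..}))"

end

(* The convergence is pathwise, with rate mu: the mollified noise is continuous, so on [0, T] the
   forced drift F(t, x) = b(x) + sigma(x) xi(t) is bounded and F / lam is Lipschitz in x. The friction
   keeps the velocity v bounded uniformly in mu, and x + (mu / lam(x)) v satisfies the first-order
   equation up to an error of order mu, so that Gronwall's inequality applies.
   Measurability in the sample point comes from the Euler scheme, which expresses solutions as
   pointwise limits of measurable functions. *)
theory Submission
  imports Defs
begin

text \<open>The solutions \<open>q\<close> and \<open>q_lim\<close> are given sample point by sample
  point, with no measurability assumed. The size of the noise on \<open>{0..T}\<close>, and with it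
  the rate constant, depends on the sample point, and no estimate uniform in \<omega> is used. The
  pathwise rate therefore yields convergence in probability through dominated convergence for the
  indicators of the exceptional events, and this is why those events must first be shown measurable.
  Since \<open>p0\<close> is arbitrary, the velocities of the two solutions need not be close near
  time 0, so only positions can be compared. The derivative of (\<mu> / lam(x)) v is (1 / lam(x))
  \<mu> v' plus a term of order \<mu>. The equation turns \<mu> v' into F - lam(x) v, so this is F /
  lam(x) - v up to order \<mu>, and the -v cancels the derivative of x. The term of order \<mu> is
  quadratic in v, hence the need for a velocity bound free of \<mu>.\<close>

section \<open>Calculus preliminaries and a Gronwall inequality\<close>

lemma C1_bounded_derivative_lipschitz:
  assumes "C1_bounded_derivative f"
  obtains L where "0 \<le> L" "\<And>x y. norm (f x - f y) \<le> L * norm (x - y)"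
proof -
  obtain f' where f': "\<And>x. (f has_derivative blinfun_apply (f' x)) (at x)"
    and bd: "bounded (range f')"
    using assms unfolding C1_bounded_derivative_def by blast
  obtain B where B: "\<And>x. norm (f' x) \<le> B"
    using bd unfolding bounded_iff by auto
  have "norm (f x - f y) \<le> B * norm (x - y)" for x y
    using differentiable_bound[of UNIV f "\<lambda>x. blinfun_apply (f' x)" B y x] f' B
    by (auto simp: norm_blinfun.rep_eq norm_minus_commute)
  moreover have "0 \<le> B" using B[of undefined] norm_ge_zero order_trans by blast
  ultimately show ?thesis using that by blast
qed

lemma C1_bounded_derivative_continuous:
  "C1_bounded_derivative f \<Longrightarrow> continuous_on UNIV f"
  unfolding C1_bounded_derivative_def
  by (metis continuous_at_imp_continuous_on has_derivative_continuous)

lemma has_real_derivative_norm_square: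
  fixes e :: "real \<Rightarrow> 'a::real_inner"
  assumes "(e has_vector_derivative e') (at t within S)"
  shows "((\<lambda>t. (norm (e t))\<^sup>2) has_real_derivative 2 * (e t \<bullet> e')) (at t within S)"
  unfolding power2_norm_eq_inner has_real_derivative_iff_has_vector_derivative
  using assms
  by (auto intro!: derivative_eq_intros simp: has_vector_derivative_def inner_commute algebra_simps)

text \<open>Shifting \<open>u\<close> by \<open>B / A\<close> makes the affine inequality
  homogeneous, and the integrating factor \<open>exp (- A * s)\<close> then makes the product
  nonincreasing. \<open>A\<close> may have either sign: a negative one expresses damping in
  \<open>velocity_bound\<close>, a positive one growth in \<open>small_mass_rate\<close>.\<close>

lemma differential_gronwall:
  fixes u :: "real \<Rightarrow> real"
  assumes der: "\<And>s. s \<in> {0..T} \<Longrightarrow> (u has_real_derivative u' s) (at s within {0..T})"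
    and le: "\<And>s. s \<in> {0..T} \<Longrightarrow> u' s \<le> A * u s + B"
    and "A \<noteq> 0" and t: "t \<in> {0..T}"
  shows "u t \<le> (u 0 + B / A) * exp (A * t) - B / A"
proof -
  define w where "w s = (u s + B / A) * exp (- A * s)" for s
  have dw: "(w has_real_derivative (u' s - (A * u s + B)) * exp (- A * s)) (at s within {0..T})"
    if "s \<in> {0..T}" for s
    unfolding w_def using der[OF that] \<open>A \<noteq> 0\<close>
    by (auto intro!: derivative_eq_intros simp: field_simps)
  have "w t \<le> w 0"
  proof (rule DERIV_nonpos_imp_decreasing_open[where f = w])
    show "0 \<le> t" using t by simp
    show "\<exists>y. DERIV w s :> y \<and> y \<le> 0" if "0 < s" "s < t" for s
    proof -
      have "at s within {0..T} = at s" using that t by (intro at_within_interior) auto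
      then show "\<exists>y. DERIV w s :> y \<and> y \<le> 0" using dw[of s] le[of s] that t
        by (intro exI[of _ "(u' s - (A * u s + B)) * exp (- A * s)"]) (auto simp: mult_nonpos_nonneg)
    qed
    have "continuous_on {0..T} w"
      by (rule DERIV_continuous_on[OF dw])
    then show "continuous_on {0..t} w" using t by (auto intro: continuous_on_subset)
  qed
  then have "w t * exp (A * t) \<le> w 0 * exp (A * t)" by (intro mult_right_mono) auto
  then show ?thesis by (simp add: w_def mult.assoc flip: exp_add)
qed

section \<open>The deterministic small-mass estimate\<close>

text \<open>Energy estimate for the squared norm of \<open>v\<close>. Damping rate
  \<open>lam0 / \<mu>\<close> and forcing \<open>K\<^sup>2 / (lam0 * \<mu>)\<close> both scale like
  1 / \<mu>, so their quotient \<open>(K / lam0)\<^sup>2\<close>, and hence the bound, is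
  independent of \<mu>.\<close>

lemma velocity_bound:
  fixes v a f :: "real \<Rightarrow> 'a::real_inner"
  assumes "\<mu> > 0" "lam0 > 0"
    and der: "\<And>s. s \<in> {0..T} \<Longrightarrow> (v has_vector_derivative a s) (at s within {0..T})"
    and eq: "\<And>s. s \<in> {0..T} \<Longrightarrow> \<mu> *\<^sub>R a s = f s - l s *\<^sub>R v s"
    and f: "\<And>s. s \<in> {0..T} \<Longrightarrow> norm (f s) \<le> K"
    and l: "\<And>s. s \<in> {0..T} \<Longrightarrow> lam0 \<le> l s"
    and t: "t \<in> {0..T}"
  shows "norm (v t) \<le> sqrt ((norm (v 0))\<^sup>2 + (K / lam0)\<^sup>2)"
proof -
  have le: "2 * (v s \<bullet> a s) \<le> (- lam0 / \<mu>) * (norm (v s))\<^sup>2 + K\<^sup>2 / (lam0 * \<mu>)"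
    if s: "s \<in> {0..T}" for s
  proof -
    have "\<mu> * (2 * (v s \<bullet> a s)) = 2 * (v s \<bullet> f s) - 2 * l s * (norm (v s))\<^sup>2"
      using arg_cong[OF eq[OF s], of "\<lambda>x. 2 * (v s \<bullet> x)"]
      by (simp add: inner_diff_right power2_norm_eq_inner algebra_simps)
    moreover have "v s \<bullet> f s \<le> norm (v s) * K"
      using norm_cauchy_schwarz[of "v s" "f s"] mult_left_mono[OF f[OF s], of "norm (v s)"] by simp
    moreover have "2 * l s * (norm (v s))\<^sup>2 \<ge> 2 * lam0 * (norm (v s))\<^sup>2"
      using l[OF s] by (intro mult_right_mono) auto
    ultimately have 1: "\<mu> * (2 * (v s \<bullet> a s)) \<le> 2 * (norm (v s) * K) - 2 * lam0 * (norm (v s))\<^sup>2"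
      by simp
    \<comment> \<open>Young's inequality, weighted so that the forcing uses up exactly half of the
      friction \<open>2 * lam0 * (norm (v s))\<^sup>2\<close>.\<close>
    have "0 \<le> (lam0 * norm (v s) - K)\<^sup>2 / lam0" using \<open>lam0 > 0\<close> by simp
    then have "2 * (norm (v s) * K) \<le> lam0 * (norm (v s))\<^sup>2 + K\<^sup>2 / lam0"
      using \<open>lam0 > 0\<close> by (simp add: power2_eq_square field_simps)
    with 1 have "\<mu> * (2 * (v s \<bullet> a s)) \<le> K\<^sup>2 / lam0 - lam0 * (norm (v s))\<^sup>2" by simp
    then show ?thesis using \<open>\<mu> > 0\<close> \<open>lam0 > 0\<close> by (simp add: field_simps)
  qed
  have "(norm (v t))\<^sup>2 \<le> ((norm (v 0))\<^sup>2 + (K\<^sup>2 / (lam0 * \<mu>)) / (- lam0 / \<mu>)) * exp ((- lam0 / \<mu>) * t)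
      - (K\<^sup>2 / (lam0 * \<mu>)) / (- lam0 / \<mu>)"
    by (rule differential_gronwall[OF has_real_derivative_norm_square[OF der] le _ t])
      (use assms in auto)
  also have "\<dots> = ((norm (v 0))\<^sup>2 - (K / lam0)\<^sup>2) * exp ((- lam0 / \<mu>) * t) + (K / lam0)\<^sup>2"
    using \<open>\<mu> > 0\<close> \<open>lam0 > 0\<close> by (simp add: power2_eq_square)
  also have "\<dots> \<le> (norm (v 0))\<^sup>2 * 1 + (K / lam0)\<^sup>2"
  proof -
    have "exp ((- lam0 / \<mu>) * t) \<le> 1" using t \<open>\<mu> > 0\<close> \<open>lam0 > 0\<close> by simp
    then have "(norm (v 0))\<^sup>2 * exp ((- lam0 / \<mu>) * t) \<le> (norm (v 0))\<^sup>2 * 1"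
      by (intro mult_left_mono) auto
    moreover have "0 \<le> (K / lam0)\<^sup>2 * exp ((- lam0 / \<mu>) * t)" by simp
    ultimately show ?thesis by (simp only: left_diff_distrib)
  qed
  finally show ?thesis by (intro real_le_rsqrt) simp
qed

text \<open>\<open>C\<close> is obtained before \<mu> and the trajectory are given, which is what
  makes the bound a rate. The Lipschitz hypothesis concerns \<open>F / lam\<close>, the right-hand
  side of the limiting equation, because only that is compared at two points.\<close>

lemma small_mass_rate:
  fixes F :: "real \<Rightarrow> 'a::real_inner \<Rightarrow> 'a" and lam :: "'a \<Rightarrow> real"
  assumes lam': "\<And>x. (lam has_derivative blinfun_apply (lam' x)) (at x)"
    and D: "\<And>x. norm (lam' x) \<le> D"
    and "0 < lam0" and lam: "\<And>x. lam0 \<le> lam x"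
    and F: "\<And>t x. t \<in> {0..T} \<Longrightarrow> norm (F t x) \<le> K"
    and L: "\<And>t x y. t \<in> {0..T} \<Longrightarrow>
      norm ((1 / lam x) *\<^sub>R F t x - (1 / lam y) *\<^sub>R F t y) \<le> L * norm (x - y)" and "0 \<le> L"
    and y: "\<And>t. t \<in> {0..T} \<Longrightarrow>
      (y has_vector_derivative (1 / lam (y t)) *\<^sub>R F t (y t)) (at t within {0..T})"
  obtains C where "\<And>\<mu> x v a t. 0 < \<mu> \<Longrightarrow>
      (\<And>t. t \<in> {0..T} \<Longrightarrow> (x has_vector_derivative v t) (at t within {0..T})) \<Longrightarrow>
      (\<And>t. t \<in> {0..T} \<Longrightarrow> (v has_vector_derivative a t) (at t within {0..T})) \<Longrightarrow>
      (\<And>t. t \<in> {0..T} \<Longrightarrow> \<mu> *\<^sub>R a t = F t (x t) - lam (x t) *\<^sub>R v t) \<Longrightarrow>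
      x 0 = y 0 \<Longrightarrow> v 0 = p0 \<Longrightarrow> t \<in> {0..T} \<Longrightarrow> norm (x t - y t) \<le> \<mu> * C"
proof -
  \<comment> \<open>\<open>V\<close> is the bound of \<open>velocity_bound\<close>. In
    \<open>N\<close>, the first term comes from replacing \<open>x - y\<close> by \<open>e\<close>,
    the second from differentiating \<open>1 / lam\<close> along the trajectory. The
    \<open>+ 1\<close> in \<open>A\<close> absorbs the cross term through 2 |e| \<mu> N \<le> |e|^2
    + (\<mu> N)^2, and it keeps \<open>A\<close> positive. The last summand of \<open>C\<close> is
    the cost of removing the correction \<open>r\<close> at the end.\<close>
  define V where "V = sqrt ((norm p0)\<^sup>2 + (K / lam0)\<^sup>2)"
  define N where "N = L * (V / lam0) + D * V * V / lam0\<^sup>2"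
  define A where "A = 2 * L + 1"
  define C where "C = sqrt (((V / lam0)\<^sup>2 + N\<^sup>2 / A) * exp (A * T)) + V / lam0"
  have A: "A > 0" unfolding A_def using \<open>0 \<le> L\<close> by simp
  have V: "V \<ge> 0" unfolding V_def by simp
  have D0: "D \<ge> 0" using D[of undefined] norm_ge_zero order_trans by blast
  show thesis
  proof (rule that[of C])
    fix \<mu> :: real and x v a :: "real \<Rightarrow> 'a" and t :: real
    assume \<mu>: "0 < \<mu>"
      and x: "\<And>t. t \<in> {0..T} \<Longrightarrow> (x has_vector_derivative v t) (at t within {0..T})"
      and v: "\<And>t. t \<in> {0..T} \<Longrightarrow> (v has_vector_derivative a t) (at t within {0..T})"
      and eq: "\<And>t. t \<in> {0..T} \<Longrightarrow> \<mu> *\<^sub>R a t = F t (x t) - lam (x t) *\<^sub>R v t"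
      and x0: "x 0 = y 0" and v0: "v 0 = p0" and t: "t \<in> {0..T}"
    have vb: "norm (v s) \<le> V" if "s \<in> {0..T}" for s
      unfolding V_def v0[symmetric]
      by (rule velocity_bound[OF \<mu> \<open>0 < lam0\<close> v eq _ _ that]) (use F lam in auto)
    have lpos: "lam z > 0" for z using lam[of z] \<open>0 < lam0\<close> by linarith
    have linv: "1 / lam z \<le> 1 / lam0" for z
      using lam[of z] \<open>0 < lam0\<close> by (simp add: frac_le)
    define r where "r s = (\<mu> / lam (x s)) *\<^sub>R v s" for s
    \<comment> \<open>The correction \<open>r\<close> makes the derivative of \<open>e\<close> free of the acceleration.\<close>
    define e where "e s = x s + r s - y s" for s
    define g where "g s = (1 / lam (x s)) *\<^sub>R F s (x s) - (1 / lam (y s)) *\<^sub>R F s (y s)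
       - (\<mu> * lam' (x s) (v s) / (lam (x s))\<^sup>2) *\<^sub>R v s" for s
    have rb: "norm (r s) \<le> \<mu> * (V / lam0)" if "s \<in> {0..T}" for s
    proof -
      have "norm (r s) = \<mu> * ((1 / lam (x s)) * norm (v s))"
        unfolding r_def using \<mu> lpos[of "x s"] by simp
      also have "\<dots> \<le> \<mu> * ((1 / lam0) * V)"
        using \<mu> lpos[of "x s"] linv vb[OF that] \<open>0 < lam0\<close> V
        by (intro mult_left_mono mult_mono) auto
      finally show ?thesis by simp
    qed
    have lx: "((\<lambda>s. lam (x s)) has_vector_derivative lam' (x s) (v s)) (at s within {0..T})"
      if "s \<in> {0..T}" for s
      using has_derivative_compose[OF x[OF that, unfolded has_vector_derivative_def] lam'[of "x s"]]
      by (simp add: has_vector_derivative_def blinfun.scaleR_right)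
    have de: "(e has_vector_derivative g s) (at s within {0..T})" if s: "s \<in> {0..T}" for s
    proof -
      have "((\<lambda>s. \<mu> / lam (x s)) has_real_derivative - (\<mu> * lam' (x s) (v s) / (lam (x s))\<^sup>2))
          (at s within {0..T})"
        using lx[OF s] lpos[of "x s"]
        unfolding has_real_derivative_iff_has_vector_derivative[symmetric]
        by (auto intro!: derivative_eq_intros simp: power2_eq_square)
      then have "(r has_vector_derivative (\<mu> / lam (x s)) *\<^sub>R a s
          + (- (\<mu> * lam' (x s) (v s) / (lam (x s))\<^sup>2)) *\<^sub>R v s) (at s within {0..T})"
        unfolding r_def by (intro has_vector_derivative_scaleR v s)
      then have "(e has_vector_derivative v s + ((\<mu> / lam (x s)) *\<^sub>R a s
          + (- (\<mu> * lam' (x s) (v s) / (lam (x s))\<^sup>2)) *\<^sub>R v s)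
          - (1 / lam (y s)) *\<^sub>R F s (y s)) (at s within {0..T})"
        unfolding e_def by (intro has_vector_derivative_add has_vector_derivative_diff x y s)
      \<comment> \<open>The term \<open>- v s\<close> cancels the derivative of \<open>x\<close>,
        leaving the limiting drift evaluated at \<open>x s\<close>.\<close>
      moreover have "(\<mu> / lam (x s)) *\<^sub>R a s = (1 / lam (x s)) *\<^sub>R F s (x s) - v s"
      proof -
        have "(\<mu> / lam (x s)) *\<^sub>R a s = (1 / lam (x s)) *\<^sub>R (\<mu> *\<^sub>R a s)" by simp
        also have "\<dots> = (1 / lam (x s)) *\<^sub>R F s (x s) - v s"
          unfolding eq[OF s] using lpos[of "x s"] by (simp add: scaleR_diff_right)
        finally show ?thesis .
      qed
      ultimately show ?thesis by (simp add: g_def algebra_simps)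
    qed
    have gb: "norm (g s) \<le> L * norm (e s) + \<mu> * N" if s: "s \<in> {0..T}" for s
    proof -
      have "norm (g s) \<le> L * norm (x s - y s)
          + norm ((\<mu> * lam' (x s) (v s) / (lam (x s))\<^sup>2) *\<^sub>R v s)"
        unfolding g_def using L[OF s, of "x s" "y s"] by (smt (verit) norm_triangle_ineq4)
      also have "L * norm (x s - y s) \<le> L * (norm (e s) + \<mu> * (V / lam0))"
      proof (intro mult_left_mono \<open>0 \<le> L\<close>)
        have "norm (x s - y s) = norm (e s - r s)" unfolding e_def by (simp add: algebra_simps)
        then show "norm (x s - y s) \<le> norm (e s) + \<mu> * (V / lam0)"
          using norm_triangle_ineq4[of "e s" "r s"] rb[OF s] by linarith
      qed
      also have "norm ((\<mu> * lam' (x s) (v s) / (lam (x s))\<^sup>2) *\<^sub>R v s) \<le> \<mu> * (D * V * V / lam0\<^sup>2)"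
      proof -
        have "\<bar>lam' (x s) (v s)\<bar> \<le> norm (lam' (x s)) * norm (v s)"
          using norm_blinfun[of "lam' (x s)" "v s"] by simp
        also have "\<dots> \<le> D * V" using D vb[OF s] D0 by (intro mult_mono) auto
        finally have 1: "\<bar>lam' (x s) (v s)\<bar> * norm (v s) \<le> D * V * V"
          using vb[OF s] D0 V by (intro mult_mono[of _ "D * V"]) auto
        have 2: "1 / (lam (x s))\<^sup>2 \<le> 1 / lam0\<^sup>2"
          using lam[of "x s"] \<open>0 < lam0\<close> by (intro frac_le power_mono) auto
        have "norm ((\<mu> * lam' (x s) (v s) / (lam (x s))\<^sup>2) *\<^sub>R v s)
            = \<mu> * ((\<bar>lam' (x s) (v s)\<bar> * norm (v s)) * (1 / (lam (x s))\<^sup>2))"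
          using \<mu> by (simp add: abs_mult)
        also have "\<dots> \<le> \<mu> * ((D * V * V) * (1 / lam0\<^sup>2))"
          using 1 2 \<mu> D0 V by (intro mult_left_mono mult_mono[of _ "D * V * V"]) auto
        finally show ?thesis by simp
      qed
      finally show ?thesis by (simp add: N_def algebra_simps)
    qed
    have le: "2 * (e s \<bullet> g s) \<le> A * (norm (e s))\<^sup>2 + (\<mu> * N)\<^sup>2" if s: "s \<in> {0..T}" for s
    proof -
      have "2 * (e s \<bullet> g s) \<le> 2 * (norm (e s) * norm (g s))"
        using norm_cauchy_schwarz by auto
      also have "\<dots> \<le> 2 * (norm (e s) * (L * norm (e s) + \<mu> * N))"
        using gb[OF s] by (intro mult_left_mono) auto
      also have "\<dots> \<le> A * (norm (e s))\<^sup>2 + (\<mu> * N)\<^sup>2"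
        using zero_le_power2[of "norm (e s) - \<mu> * N"]
        by (simp add: A_def power2_eq_square algebra_simps)
      finally show ?thesis .
    qed
    have "(norm (e t))\<^sup>2 \<le> ((norm (e 0))\<^sup>2 + (\<mu> * N)\<^sup>2 / A) * exp (A * t) - (\<mu> * N)\<^sup>2 / A"
      by (rule differential_gronwall[OF has_real_derivative_norm_square[OF de] le _ t]) (use A in auto)
    also have "\<dots> \<le> ((norm (e 0))\<^sup>2 + (\<mu> * N)\<^sup>2 / A) * exp (A * t)" using A by simp
    also have "\<dots> \<le> ((\<mu> * (V / lam0))\<^sup>2 + (\<mu> * N)\<^sup>2 / A) * exp (A * T)"
    proof (intro mult_mono add_mono power_mono)
      \<comment> \<open>Since \<open>x 0 = y 0\<close>, the initial error is \<open>r 0\<close>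
        alone: it need not vanish, but it is of order \<mu>.\<close>
      show "norm (e 0) \<le> \<mu> * (V / lam0)"
        using rb[of 0] t x0 by (auto simp: e_def)
    qed (use A t in auto)
    also have "\<dots> = \<mu>\<^sup>2 * (((V / lam0)\<^sup>2 + N\<^sup>2 / A) * exp (A * T))"
      by (simp only: power_mult_distrib) (simp add: ring_distribs mult.assoc)
    finally have "norm (e t) \<le> sqrt (\<mu>\<^sup>2 * (((V / lam0)\<^sup>2 + N\<^sup>2 / A) * exp (A * T)))"
      by (rule real_le_rsqrt)
    also have "\<dots> = \<mu> * sqrt (((V / lam0)\<^sup>2 + N\<^sup>2 / A) * exp (A * T))"
      using \<mu> by (simp add: real_sqrt_mult)
    finally have eb: "norm (e t) \<le> \<mu> * sqrt (((V / lam0)\<^sup>2 + N\<^sup>2 / A) * exp (A * T))" .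
    have "norm (x t - y t) = norm (e t - r t)" unfolding e_def by (simp add: algebra_simps)
    then show "norm (x t - y t) \<le> \<mu> * C"
      using norm_triangle_ineq4[of "e t" "r t"] rb[OF t] eb by (simp add: C_def algebra_simps)
  qed
qed

section \<open>Euler scheme and measurability of solutions\<close>

fun euler_scheme :: "(real \<Rightarrow> 'a::real_vector \<Rightarrow> 'a) \<Rightarrow> 'a \<Rightarrow> real \<Rightarrow> nat \<Rightarrow> 'a" where
  "euler_scheme H z0 h 0 = z0"
| "euler_scheme H z0 h (Suc k) =
     euler_scheme H z0 h k + h *\<^sub>R H (real k * h) (euler_scheme H z0 h k)"

text \<open>The Lipschitz bound is only required against the values on the trajectory itself. This covers
  the second-order system, whose friction term \<open>lam x *\<^sub>R v\<close> is not globally Lipschitz in \<open>(x, v)\<close>.\<close>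

lemma euler_scheme_tendsto:
  fixes z :: "real \<Rightarrow> 'a::real_normed_vector"
  assumes "0 \<le> T"
    and der: "\<And>t. t \<in> {0..T} \<Longrightarrow> (z has_vector_derivative H t (z t)) (at t within {0..T})"
    and cont: "continuous_on {0..T} (\<lambda>t. H t (z t))"
    and L: "\<And>t y. t \<in> {0..T} \<Longrightarrow> norm (H t y - H t (z t)) \<le> L * norm (y - z t)"
  shows "(\<lambda>n. euler_scheme H (z 0) (T / Suc n) (Suc n)) \<longlonglongrightarrow> z T"
proof -
  define L' where "L' = max L 0"
  have L': "0 \<le> L'" "\<And>t y. t \<in> {0..T} \<Longrightarrow> norm (H t y - H t (z t)) \<le> L' * norm (y - z t)"
    by (auto simp: L'_def intro!: order_trans[OF L mult_right_mono])
  have uc: "uniformly_continuous_on {0..T} (\<lambda>t. H t (z t))"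
    using cont by (intro compact_uniformly_continuous) auto
  \<comment> \<open>Each step adds a local error \<open>h * \<epsilon>\<close> and amplifies the
    earlier ones by \<open>1 + h * L'\<close>. Bounding every amplification by the full power,
    instead of summing a geometric series, avoids dividing by \<open>L'\<close>, which may be 0.
    Here \<epsilon> bounds the oscillation of the derivative of \<open>z\<close> over a distance
    \<open>h\<close>.\<close>
  have err: "norm (euler_scheme H (z 0) h k - z (real k * h)) \<le> real k * (h * \<epsilon>) * (1 + h * L') ^ k"
    if h: "0 \<le> h" "real n * h = T" and "0 \<le> \<epsilon>"
      and mod: "\<And>s t. s \<in> {0..T} \<Longrightarrow> t \<in> {0..T} \<Longrightarrow> \<bar>s - t\<bar> \<le> h \<Longrightarrow> norm (H s (z s) - H t (z t)) \<le> \<epsilon>"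
      and "k \<le> n"
    for h \<epsilon> n k
    using \<open>k \<le> n\<close>
  proof (induction k)
    case (Suc k)
    let ?E = "euler_scheme H (z 0) h k" and ?t = "real k * h" and ?c = "1 + h * L'"
    have t': "real (Suc k) * h = ?t + h" by (simp add: algebra_simps)
    have tT: "?t + h \<le> T" using Suc.prems h mult_right_mono[of "real (Suc k)" "real n" h]
      by (simp add: algebra_simps)
    have t0: "0 \<le> ?t" using h by simp
    \<comment> \<open>Local truncation error: over one step the derivative of \<open>z\<close> stays
      within \<epsilon> of its value at the left endpoint.\<close>
    have "norm (z (?t + h) - z ?t - (?t + h - ?t) *\<^sub>R H ?t (z ?t)) \<le> norm (?t + h - ?t) * \<epsilon>"
    proof (rule vector_differentiable_bound_linearization[where S = "{?t..?t + h}"])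
      fix s assume s: "s \<in> {?t..?t + h}"
      show "(z has_vector_derivative H s (z s)) (at s within {?t..?t + h})"
        using s t0 tT order_trans[OF t0, of s]
        by (intro has_vector_derivative_within_subset[OF der]) auto
      show "norm (H s (z s) - H ?t (z ?t)) \<le> \<epsilon>"
        using s t0 tT h order_trans[OF t0, of s] by (intro mod) auto
    qed (use h in \<open>auto simp: closed_segment_eq_real_ivl\<close>)
    then have 1: "norm (z (?t + h) - z ?t - h *\<^sub>R H ?t (z ?t)) \<le> h * \<epsilon>" using h by simp
    have 2: "norm (h *\<^sub>R (H ?t ?E - H ?t (z ?t))) \<le> h * (L' * norm (?E - z ?t))"
      using h t0 tT L'(2)[of ?t ?E] by (auto intro!: mult_left_mono)
    have c: "1 \<le> ?c" using h L' by simp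
    have "euler_scheme H (z 0) h (Suc k) - z (?t + h)
       = (?E - z ?t) + h *\<^sub>R (H ?t ?E - H ?t (z ?t)) - (z (?t + h) - z ?t - h *\<^sub>R H ?t (z ?t))"
      by (simp add: algebra_simps)
    then have "norm (euler_scheme H (z 0) h (Suc k) - z (?t + h))
       \<le> norm (?E - z ?t) + h * (L' * norm (?E - z ?t)) + h * \<epsilon>"
      using 1 2 by (smt (verit) norm_triangle_ineq norm_triangle_ineq4)
    also have "\<dots> = ?c * norm (?E - z ?t) + h * \<epsilon>" by (simp add: algebra_simps)
    also have "\<dots> \<le> ?c * (real k * (h * \<epsilon>) * ?c ^ k) + h * \<epsilon> * ?c ^ Suc k"
    proof (intro add_mono mult_left_mono)
      show "h * \<epsilon> \<le> h * \<epsilon> * ?c ^ Suc k"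
        using mult_left_mono[OF one_le_power[OF c, of "Suc k"], of "h * \<epsilon>"] h \<open>0 \<le> \<epsilon>\<close> by simp
    qed (use Suc c in auto)
    also have "\<dots> = real (Suc k) * (h * \<epsilon>) * ?c ^ Suc k" by (simp add: algebra_simps)
    finally show ?case unfolding t' .
  qed simp
  show ?thesis
  proof (rule LIMSEQ_I)
    fix r :: real assume "0 < r"
    \<comment> \<open>The global error is at most \<open>T * \<epsilon> * exp (T * L')\<close>.
      Writing \<open>T + 1\<close> for \<open>T\<close> keeps the denominator nonzero when
      \<open>T = 0\<close>, and the factor 2 leaves room for the strict inequality.\<close>
    define \<epsilon> where "\<epsilon> = r / (2 * ((T + 1) * exp (T * L')))"
    have \<epsilon>: "0 < \<epsilon>" unfolding \<epsilon>_def using \<open>0 < r\<close> \<open>0 \<le> T\<close> by simp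
    obtain d where d: "0 < d"
      "\<And>s t. s \<in> {0..T} \<Longrightarrow> t \<in> {0..T} \<Longrightarrow> dist t s < d \<Longrightarrow> dist (H t (z t)) (H s (z s)) < \<epsilon>"
      using uc \<epsilon> unfolding uniformly_continuous_on_def by metis
    obtain N where N: "T / d < real N" using reals_Archimedean2 by blast
    show "\<exists>no. \<forall>n\<ge>no. norm (euler_scheme H (z 0) (T / Suc n) (Suc n) - z T) < r"
    proof (intro exI allI impI)
      fix n assume n: "N \<le> n"
      let ?h = "T / Suc n"
      have h: "0 \<le> ?h" "real (Suc n) * ?h = T" using \<open>0 \<le> T\<close> by auto
      have hd: "?h < d" using N n d(1) by (simp add: field_simps) (smt (verit) mult_left_mono of_nat_mono)
      have "norm (euler_scheme H (z 0) ?h (Suc n) - z (real (Suc n) * ?h))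
         \<le> real (Suc n) * (?h * \<epsilon>) * (1 + ?h * L') ^ Suc n"
      proof (rule err[OF h])
        fix s t assume "s \<in> {0..T}" "t \<in> {0..T}" "\<bar>s - t\<bar> \<le> ?h"
        then show "norm (H s (z s) - H t (z t)) \<le> \<epsilon>"
          using d(2)[of t s] hd by (auto simp: dist_norm)
      qed (use \<epsilon> in auto)
      also have "\<dots> = (T * \<epsilon>) * (1 + ?h * L') ^ Suc n" using h(2) by simp
      also have "\<dots> \<le> (T * \<epsilon>) * exp (?h * L') ^ Suc n"
        using mult_nonneg_nonneg[OF h(1) L'(1)] \<open>0 \<le> T\<close> \<epsilon>
        by (intro mult_left_mono power_mono) (simp_all del: of_nat_Suc)
      also have "exp (?h * L') ^ Suc n = exp (T * L')"
        unfolding exp_of_nat_mult[symmetric] using h(2) by (simp add: mult.assoc[symmetric] del: of_nat_Suc)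
      also have "T * \<epsilon> * exp (T * L') \<le> (T + 1) * exp (T * L') * \<epsilon>" using \<epsilon> by (simp add: algebra_simps)
      also have "\<dots> = r / 2"
      proof -
        have "c * (r / (2 * c)) = r / 2" if "c \<noteq> 0" for c :: real using that by simp
        then show ?thesis unfolding \<epsilon>_def using \<open>0 \<le> T\<close> by simp
      qed
      also have "\<dots> < r" using \<open>0 < r\<close> by simp
      finally show "norm (euler_scheme H (z 0) ?h (Suc n) - z T) < r"
        unfolding h(2) .
    qed
  qed
qed

text \<open>Every Euler iterate is measurable by induction, and the solution is their pointwise
  limit. Nothing is assumed about the measurability of \<open>z\<close> itself, and the Lipschitz
  constant may depend on \<omega>, since pointwise convergence suffices.\<close>

lemma ode_solution_measurable:
  fixes z :: "real \<Rightarrow> 'w \<Rightarrow> 'a::{real_normed_vector, second_countable_topology}"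
  assumes "0 \<le> T"
    and meas: "\<And>t y. t \<in> {0..T} \<Longrightarrow> y \<in> borel_measurable M \<Longrightarrow> (\<lambda>\<omega>. H t \<omega> (y \<omega>)) \<in> borel_measurable M"
    and init: "\<And>\<omega>. \<omega> \<in> space M \<Longrightarrow> z 0 \<omega> = z0"
    and der: "\<And>t \<omega>. t \<in> {0..T} \<Longrightarrow> \<omega> \<in> space M \<Longrightarrow>
      ((\<lambda>t. z t \<omega>) has_vector_derivative H t \<omega> (z t \<omega>)) (at t within {0..T})"
    and cont: "\<And>\<omega>. \<omega> \<in> space M \<Longrightarrow> continuous_on {0..T} (\<lambda>t. H t \<omega> (z t \<omega>))"
    and L: "\<And>\<omega>. \<omega> \<in> space M \<Longrightarrow>
      \<exists>L. \<forall>t\<in>{0..T}. \<forall>y. norm (H t \<omega> y - H t \<omega> (z t \<omega>)) \<le> L * norm (y - z t \<omega>)"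
  shows "z T \<in> borel_measurable M"
proof (rule borel_measurable_LIMSEQ_metric)
  have *: "(\<lambda>\<omega>. euler_scheme (\<lambda>t. H t \<omega>) z0 h k) \<in> borel_measurable M"
    if "0 \<le> h" "real n * h \<le> T" "k \<le> n" for h n k
    using \<open>k \<le> n\<close>
  proof (induction k)
    case (Suc k)
    have "real k * h \<le> real n * h" using Suc.prems that by (intro mult_right_mono) auto
    then have "real k * h \<in> {0..T}" using that by auto
    then show ?case using Suc by (auto intro!: borel_measurable_add borel_measurable_scaleR meas)
  qed simp
  show "(\<lambda>\<omega>. euler_scheme (\<lambda>t. H t \<omega>) z0 (T / Suc n) (Suc n)) \<in> borel_measurable M" for n
    by (rule *[of _ "Suc n"]) (use \<open>0 \<le> T\<close> in auto)
  fix \<omega> assume \<omega>: "\<omega> \<in> space M"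
  obtain L where "\<And>t y. t \<in> {0..T} \<Longrightarrow> norm (H t \<omega> y - H t \<omega> (z t \<omega>)) \<le> L * norm (y - z t \<omega>)"
    using L[OF \<omega>] by blast
  then show "(\<lambda>n. euler_scheme (\<lambda>t. H t \<omega>) z0 (T / Suc n) (Suc n)) \<longlonglongrightarrow> z T \<omega>"
    using euler_scheme_tendsto[of T "\<lambda>t. z t \<omega>" "\<lambda>t. H t \<omega>" L] \<omega> \<open>0 \<le> T\<close> der cont init by auto
qed

section \<open>The mollified noise\<close>

lemma matrix_vector_mult_bounded_bilinear:
  "bounded_bilinear ((*v) :: real ^ 'n ^ 'm \<Rightarrow> real ^ 'n \<Rightarrow> real ^ 'm)"
  unfolding bilinear_conv_bounded_bilinear[symmetric] bilinear_def
  by (auto intro!: linearI simp: matrix_vector_mult_add_rdistrib matrix_vector_right_distrib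
      matrix_vector_mult_scaleR simp flip: scaleR_matrix_vector_assoc)

lemma mollifier_facts:
  assumes "mollifier \<rho>"
  shows "(\<rho> has_real_derivative deriv \<rho> s) (at s)" and "continuous_on S (deriv \<rho>)"
    and "1 < s \<Longrightarrow> \<rho> s = 0"
proof -
  have sm: "(deriv ^^ n) \<rho> differentiable_on UNIV" for n
    using assms unfolding mollifier_def smooth_real_def by blast
  show "(\<rho> has_real_derivative deriv \<rho> s) (at s)"
    using sm[of 0] by (auto simp: differentiable_on_def DERIV_deriv_iff_real_differentiable)
  show "continuous_on S (deriv \<rho>)"
    using differentiable_imp_continuous_on[OF sm[of 1]] continuous_on_subset by auto
  have "{s. \<rho> s \<noteq> 0} \<subseteq> {0..1}"
    using assms order_trans[OF closure_subset] unfolding mollifier_def by auto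
  then show "1 < s \<Longrightarrow> \<rho> s = 0" by force
qed

text \<open>The path \<open>w\<close> is only continuous, so the time derivative is moved onto the
  kernel by differentiation under the integral. This works because near \<open>t\<close> the
  half-line can be replaced by one compact interval that does not depend on the time.\<close>

lemma mollified_noise_eq:
  fixes w :: "real \<Rightarrow> real ^ 'd"
  assumes \<rho>: "mollifier \<rho>" and "\<delta> > 0" and w: "continuous_on {0..} w" and t: "t \<in> {0..T}"
  shows "mollified_noise \<rho> \<delta> w t
     = integral {0..T + 1 + \<delta>} (\<lambda>s. (- deriv \<rho> ((s - t) / \<delta>) / \<delta>\<^sup>2) *\<^sub>R w s)"
proof -
  \<comment> \<open>\<open>?U\<close> is an open neighbourhood of \<open>{0..T}\<close>, so the
    derivative obtained is two-sided at 0 and at \<open>T\<close> as well. For \<open>u\<close> in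
    \<open>?U\<close> the kernel vanishes beyond \<open>u + \<delta>\<close>, hence beyond
    \<open>?R\<close>.\<close>
  let ?U = "{-1<..<T + 1}" and ?R = "T + 1 + \<delta>"
  let ?f = "\<lambda>t s. (\<rho> ((s - t) / \<delta>) / \<delta>) *\<^sub>R w s"
  let ?g = "\<lambda>t s. (- deriv \<rho> ((s - t) / \<delta>) / \<delta>\<^sup>2) *\<^sub>R w s"
  have cw: "continuous_on {0..?R} w" using w by (rule continuous_on_subset) auto
  have c\<rho>: "continuous_on S \<rho>" for S
    using mollifier_facts(1)[OF \<rho>] by (meson DERIV_continuous_on has_field_derivative_at_within)
  have path: "integral {0..?R} (?f u) = mollified_path \<rho> \<delta> w u" if "u \<in> ?U" for u
  proof -
    have "mollified_path \<rho> \<delta> w u = integral {0..} (?f u)"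
      unfolding mollified_path_def by (simp flip: integral_cmul)
    also have "\<dots> = integral {0..} (\<lambda>s. if s \<in> {0..?R} then ?f u s else 0)"
    proof (rule integral_cong)
      fix s :: real assume s: "s \<in> {0..}"
      have "\<rho> ((s - u) / \<delta>) = 0" if "s > ?R"
        using that \<open>u \<in> ?U\<close> \<open>\<delta> > 0\<close> by (intro mollifier_facts(3)[OF \<rho>]) (auto simp: field_simps)
      then show "?f u s = (if s \<in> {0..?R} then ?f u s else 0)" using s by auto
    qed
    also have "\<dots> = integral ({0..?R} \<inter> {0..}) (?f u)" by (rule integral_restrict_Int)
    also have "{0..?R} \<inter> {0..} = {0..?R}" by auto
    finally show ?thesis ..
  qed
  have "((\<lambda>u. integral (cbox 0 ?R) (?f u)) has_vector_derivative integral (cbox 0 ?R) (?g t))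
      (at t within ?U)"
  proof (rule leibniz_rule_vector_derivative)
    fix u s assume "u \<in> ?U" "s \<in> cbox 0 ?R"
    have "((\<lambda>u. \<rho> ((s - u) / \<delta>) / \<delta>) has_real_derivative - deriv \<rho> ((s - u) / \<delta>) / \<delta>\<^sup>2) (at u within ?U)"
      using \<open>\<delta> > 0\<close>
      by (auto intro!: derivative_eq_intros DERIV_chain2[OF mollifier_facts(1)[OF \<rho>]]
          simp: power2_eq_square field_simps)
    then show "((\<lambda>u. ?f u s) has_vector_derivative ?g u s) (at u within ?U)"
      unfolding has_real_derivative_iff_has_vector_derivative
      by (rule bounded_linear.has_vector_derivative[OF bounded_linear_scaleR_left])
  next
    fix u show "?f u integrable_on cbox 0 ?R"
      using \<open>\<delta> > 0\<close>
      by (intro integrable_continuous continuous_intros continuous_on_compose2[OF c\<rho>[of UNIV]]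
          continuous_on_compose2[OF cw]) auto
  next
    show "continuous_on (?U \<times> cbox 0 ?R) (\<lambda>(u, s). ?g u s)"
      unfolding case_prod_beta using \<open>\<delta> > 0\<close>
      by (intro continuous_intros continuous_on_compose2[OF mollifier_facts(2)[OF \<rho>, of UNIV]]
          continuous_on_compose2[OF cw]) auto
  qed (use t in auto)
  then have "((\<lambda>u. integral {0..?R} (?f u)) has_vector_derivative integral {0..?R} (?g t)) (at t)"
    using at_within_open[of t ?U] t by simp
  then have "(mollified_path \<rho> \<delta> w has_vector_derivative integral {0..?R} (?g t)) (at t)"
    by (rule has_vector_derivative_transform_within_open[where S = ?U]) (use path t in auto)
  then show ?thesis unfolding mollified_noise_def by (rule vector_derivative_at)
qed

lemma continuous_on_mollified_noise:
  assumes \<rho>: "mollifier \<rho>" and "\<delta> > 0" and w: "continuous_on {0..} w"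
  shows "continuous_on {0..T} (mollified_noise \<rho> \<delta> w)"
proof -
  have cw: "continuous_on {0..T + 1 + \<delta>} w" using w by (rule continuous_on_subset) auto
  have "continuous_on {0..T}
     (\<lambda>t. integral (cbox 0 (T + 1 + \<delta>)) (\<lambda>s. (- deriv \<rho> ((s - t) / \<delta>) / \<delta>\<^sup>2) *\<^sub>R w s))"
    unfolding case_prod_beta using \<open>\<delta> > 0\<close>
    by (intro integral_continuous_on_param, unfold case_prod_beta,
        intro continuous_intros continuous_on_compose2[OF mollifier_facts(2)[OF \<rho>, of UNIV]]
          continuous_on_compose2[OF cw]) auto
  then show ?thesis
    by (rule continuous_on_eq) (simp only: cbox_interval mollified_noise_eq[OF assms])
qed

text \<open>A running integral solves a differential equation whose right-hand side ignores the
  state, with Lipschitz constant 0. Its Euler iterates are Riemann sums, so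
  \<open>ode_solution_measurable\<close> gives measurability from that of each \<open>W t\<close>,
  without joint measurability in time and sample point.\<close>

lemma borel_measurable_mollified_noise:
  fixes W :: "real \<Rightarrow> 'w \<Rightarrow> real ^ 'd"
  assumes \<rho>: "mollifier \<rho>" and "\<delta> > 0" and "0 \<le> t"
    and W: "\<And>t. 0 \<le> t \<Longrightarrow> W t \<in> borel_measurable M"
    and cont: "\<And>\<omega>. \<omega> \<in> space M \<Longrightarrow> continuous_on {0..} (\<lambda>t. W t \<omega>)"
  shows "(\<lambda>\<omega>. mollified_noise \<rho> \<delta> (\<lambda>t. W t \<omega>) t) \<in> borel_measurable M"
proof -
  let ?g = "\<lambda>s \<omega>. (- deriv \<rho> ((s - t) / \<delta>) / \<delta>\<^sup>2) *\<^sub>R W s \<omega>"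
  have cg: "continuous_on {0..t + 1 + \<delta>} (\<lambda>s. ?g s \<omega>)" if "\<omega> \<in> space M" for \<omega>
    using \<open>\<delta> > 0\<close>
    by (intro continuous_intros continuous_on_compose2[OF mollifier_facts(2)[OF \<rho>, of UNIV]]
          continuous_on_compose2[OF cont[OF that]]) auto
  have "(\<lambda>\<omega>. integral {0..t + 1 + \<delta>} (\<lambda>s. ?g s \<omega>)) \<in> borel_measurable M"
  proof (rule ode_solution_measurable[where H = "\<lambda>s \<omega> y. ?g s \<omega>" and T = "t + 1 + \<delta>"
        and z = "\<lambda>r \<omega>. integral {0..r} (\<lambda>s. ?g s \<omega>)" and ?z0.0 = 0])
    show "((\<lambda>r. integral {0..r} (\<lambda>s. ?g s \<omega>)) has_vector_derivative ?g r \<omega>) (at r within {0..t + 1 + \<delta>})"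
      if "r \<in> {0..t + 1 + \<delta>}" "\<omega> \<in> space M" for r \<omega>
      using cg that by (intro integral_has_vector_derivative)
    show "\<exists>L. \<forall>s\<in>{0..t + 1 + \<delta>}. \<forall>y. norm (?g s \<omega> - ?g s \<omega>)
        \<le> L * norm (y - integral {0..s} (\<lambda>s. ?g s \<omega>))" for \<omega>
      by (intro exI[of _ 0]) simp
  qed (use assms cg in auto)
  then show ?thesis
    by (rule subst[OF measurable_cong, rotated]) (use assms in \<open>auto simp: mollified_noise_eq[OF \<rho> \<open>\<delta> > 0\<close> cont, of _ t t]\<close>)
qed

section \<open>From pathwise convergence to convergence in probability\<close>

text \<open>By continuity, \<kappa> is exceeded somewhere exactly if it is exceeded at a rational
  time, which turns the event into a countable union.\<close>

lemma SUP_greater_measurable: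
  fixes f :: "real \<Rightarrow> 'w \<Rightarrow> real"
  assumes "0 < T"
    and meas: "\<And>t. t \<in> {0..T} \<Longrightarrow> f t \<in> borel_measurable M"
    and cont: "\<And>\<omega>. \<omega> \<in> space M \<Longrightarrow> continuous_on {0..T} (\<lambda>t. f t \<omega>)"
  shows "{\<omega> \<in> space M. (SUP t\<in>{0..T}. f t \<omega>) > \<kappa>} \<in> sets M"
proof -
  \<comment> \<open>Openness of the interval transfers the density of the rationals to it; its
    closure recovers both endpoints because \<open>0 < T\<close>.\<close>
  let ?Q = "{0<..<T} \<inter> \<rat>"
  have cl: "closure ?Q = {0..T}"
  proof
    show "closure ?Q \<subseteq> {0..T}" by (intro closure_minimal) auto
    have "{0<..<T} \<subseteq> closure ?Q"
      using open_Int_closure_subset[of "{0<..<T}" \<rat>] by (simp add: Rats_closure_real)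
    then have "closure {0<..<T} \<subseteq> closure (closure ?Q)" by (rule closure_mono)
    then show "{0..T} \<subseteq> closure ?Q" using \<open>0 < T\<close> by simp
  qed
  have "(SUP t\<in>{0..T}. f t \<omega>) > \<kappa> \<longleftrightarrow> (\<exists>t\<in>?Q. f t \<omega> > \<kappa>)" if \<omega>: "\<omega> \<in> space M" for \<omega>
  proof -
    have "bdd_above ((\<lambda>t. f t \<omega>) ` {0..T})"
      using compact_continuous_image[OF cont[OF \<omega>]] by (simp add: compact_imp_bounded bounded_imp_bdd_above)
    then have "(SUP t\<in>{0..T}. f t \<omega>) > \<kappa> \<longleftrightarrow> (\<exists>t\<in>{0..T}. f t \<omega> > \<kappa>)"
      using \<open>0 < T\<close> by (intro less_cSUP_iff) auto
    moreover have "(\<exists>t\<in>{0..T}. f t \<omega> > \<kappa>) \<longleftrightarrow> (\<exists>t\<in>?Q. f t \<omega> > \<kappa>)"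
    proof
      assume "\<exists>t\<in>{0..T}. f t \<omega> > \<kappa>"
      then obtain t where t: "t \<in> {0..T}" "f t \<omega> > \<kappa>" by blast
      show "\<exists>t\<in>?Q. f t \<omega> > \<kappa>"
      proof (rule ccontr)
        assume no: "\<not> ?thesis"
        have "f t \<omega> \<le> \<kappa>"
          by (rule continuous_le_on_closure[of ?Q "\<lambda>t. f t \<omega>" t \<kappa>, unfolded cl])
            (use cont[OF \<omega>] t(1) no in \<open>auto simp: not_less\<close>)
        with t(2) show False by simp
      qed
    qed auto
    ultimately show ?thesis by simp
  qed
  then have "{\<omega> \<in> space M. (SUP t\<in>{0..T}. f t \<omega>) > \<kappa>} = (\<Union>t\<in>?Q. {\<omega> \<in> space M. f t \<omega> > \<kappa>})"
    by auto
  also have "\<dots> \<in> sets M"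
  proof (rule sets.countable_UN'')
    show "countable ?Q" using countable_rat by (rule countable_subset[rotated]) auto
    show "{\<omega> \<in> space M. f t \<omega> > \<kappa>} \<in> sets M" if "t \<in> ?Q" for t
    proof -
      have [measurable]: "f t \<in> borel_measurable M" using meas that by auto
      show ?thesis by measurable
    qed
  qed
  finally show ?thesis .
qed

text \<open>Dominated convergence for indicators. The threshold below which \<omega> leaves
  \<open>A \<mu>\<close> may vary with \<omega>. As dominated convergence is a statement about
  sequences, the limit is tested along sequences decreasing to 0; the 1 below is an arbitrary
  positive bound for them.\<close>

lemma (in prob_space) prob_tendsto_0_at_right:
  assumes A: "\<And>\<mu>::real. \<mu> > 0 \<Longrightarrow> A \<mu> \<in> sets M"
    and ev: "\<And>\<omega>. \<omega> \<in> space M \<Longrightarrow> eventually (\<lambda>\<mu>. \<omega> \<notin> A \<mu>) (at_right 0)"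
  shows "((\<lambda>\<mu>. prob (A \<mu>)) \<longlongrightarrow> 0) (at_right 0)"
proof (rule tendsto_at_right_sequentially[of 0 1])
  fix S :: "nat \<Rightarrow> real" assume S: "\<And>n. 0 < S n" "S \<longlonglongrightarrow> 0"
  have fl: "filterlim S (at_right 0) sequentially"
    using S by (intro tendsto_imp_filterlim_at_right) auto
  have "(\<lambda>n. \<integral>\<omega>. indicat_real (A (S n)) \<omega> \<partial>M) \<longlonglongrightarrow> (\<integral>\<omega>. 0 \<partial>M)"
  proof (rule integral_dominated_convergence[where w = "\<lambda>_. 1"])
    show "AE \<omega> in M. (\<lambda>n. indicat_real (A (S n)) \<omega>) \<longlonglongrightarrow> 0"
    proof (rule AE_I2)
      fix \<omega> assume "\<omega> \<in> space M"
      then have "eventually (\<lambda>n. \<omega> \<notin> A (S n)) sequentially"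
        using ev fl by (auto simp: filterlim_iff)
      then show "(\<lambda>n. indicat_real (A (S n)) \<omega>) \<longlonglongrightarrow> 0"
        by (intro tendsto_eventually) (auto elim: eventually_mono)
    qed
  qed (use A S in \<open>auto simp: indicator_def\<close>)
  then show "(\<lambda>n. prob (A (S n))) \<longlonglongrightarrow> 0"
    using A S sets.sets_into_space by (simp add: Int_absorb2)
qed simp

section \<open>Bounds for the forced drift\<close>

lemma forced_drift_bounds:
  fixes b :: "'a::real_normed_vector \<Rightarrow> real ^ 'm" and \<sigma> :: "'a \<Rightarrow> real ^ 'n ^ 'm"
  assumes "C1_bounded_derivative b" "bounded (range b)"
    and "C1_bounded_derivative \<sigma>" "bounded (range \<sigma>)"
  obtains K L where "0 \<le> L" "\<And>e x. norm e \<le> X \<Longrightarrow> norm (b x + \<sigma> x *v e) \<le> K"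
    "\<And>e x y. norm e \<le> X \<Longrightarrow> norm (b x + \<sigma> x *v e - (b y + \<sigma> y *v e)) \<le> L * norm (x - y)"
proof -
  obtain Lb where Lb: "0 \<le> Lb" "\<And>x y. norm (b x - b y) \<le> Lb * norm (x - y)"
    using C1_bounded_derivative_lipschitz[OF assms(1)] by blast
  obtain Ls where Ls: "0 \<le> Ls" "\<And>x y. norm (\<sigma> x - \<sigma> y) \<le> Ls * norm (x - y)"
    using C1_bounded_derivative_lipschitz[OF assms(3)] by blast
  obtain Bb where Bb: "\<And>x. norm (b x) \<le> Bb" using assms(2) by (auto simp: bounded_iff)
  obtain Bs where Bs: "\<And>x. norm (\<sigma> x) \<le> Bs" using assms(4) by (auto simp: bounded_iff)
  obtain C where C: "0 < C" "\<And>(A :: real ^ 'n ^ 'm) e. norm (A *v e) \<le> norm A * norm e * C"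
    using bounded_bilinear.pos_bounded[OF matrix_vector_mult_bounded_bilinear] by metis
  have Bs0: "0 \<le> Bs" using Bs[of undefined] norm_ge_zero order_trans by blast
  \<comment> \<open>\<open>X\<close> may be negative, in which case the bounds are vacuous;
    \<open>max X 0\<close> still keeps the Lipschitz constant nonnegative.\<close>
  have Av: "norm (A *v e) \<le> B * (max X 0 * C)" if "norm A \<le> B" "norm e \<le> X" for A :: "real ^ 'n ^ 'm" and e B
  proof -
    have "0 \<le> B" using that(1) norm_ge_zero order_trans by blast
    then have "norm A * norm e * C \<le> B * max X 0 * C"
      using that C(1) by (intro mult_right_mono mult_mono) auto
    with C(2)[of A e] show ?thesis by (simp add: mult.assoc)
  qed
  show thesis
  proof (rule that[of "Lb + Ls * (max X 0 * C)" "Bb + Bs * (max X 0 * C)"])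
    show "0 \<le> Lb + Ls * (max X 0 * C)" using Lb(1) Ls(1) C(1) by simp
    fix e :: "real ^ 'n" assume e: "norm e \<le> X"
    fix x
    show "norm (b x + \<sigma> x *v e) \<le> Bb + Bs * (max X 0 * C)"
      by (rule norm_triangle_mono[OF Bb Av[OF Bs e]])
    fix y
    have eq: "b x + \<sigma> x *v e - (b y + \<sigma> y *v e) = (b x - b y) + (\<sigma> x - \<sigma> y) *v e"
      by (simp add: matrix_vector_mult_diff_rdistrib)
    have "norm (b x + \<sigma> x *v e - (b y + \<sigma> y *v e))
       \<le> Lb * norm (x - y) + (Ls * norm (x - y)) * (max X 0 * C)"
      unfolding eq by (rule norm_triangle_mono[OF Lb(2) Av[OF Ls(2) e]])
    then show "norm (b x + \<sigma> x *v e - (b y + \<sigma> y *v e)) \<le> (Lb + Ls * (max X 0 * C)) * norm (x - y)"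
      by (simp add: algebra_simps)
  qed
qed

text \<open>The difference splits as (F x - F y) / lam x + (1 / lam x - 1 / lam y) F y, so a bound
  on \<open>F\<close> is required at \<open>y\<close> only.\<close>

lemma lipschitz_divide_scalar:
  fixes F :: "'a::real_normed_vector \<Rightarrow> 'b::real_normed_vector" and lam :: "'a \<Rightarrow> real"
  assumes "norm (F x - F y) \<le> L * norm (x - y)" "norm (F y) \<le> K"
    and "\<bar>lam x - lam y\<bar> \<le> D * norm (x - y)" "0 < lam0" "lam0 \<le> lam x" "lam0 \<le> lam y"
  shows "norm ((1 / lam x) *\<^sub>R F x - (1 / lam y) *\<^sub>R F y)
     \<le> (L / lam0 + D * K / lam0\<^sup>2) * norm (x - y)"
proof -
  have K: "0 \<le> K" using assms(2) norm_ge_zero order_trans by blast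
  have LN: "0 \<le> L * norm (x - y)" using assms(1) norm_ge_zero order_trans by blast
  have DN: "0 \<le> D * norm (x - y)" using assms(3) abs_ge_zero order_trans by blast
  have "norm ((1 / lam x) *\<^sub>R (F x - F y)) \<le> (L * norm (x - y)) / lam0"
    using assms LN by (auto intro!: frac_le)
  moreover have "norm ((1 / lam x - 1 / lam y) *\<^sub>R F y) \<le> (D * norm (x - y) / lam0\<^sup>2) * K"
  proof -
    have "\<bar>1 / lam x - 1 / lam y\<bar> = \<bar>lam x - lam y\<bar> / (lam x * lam y)"
      using assms(4-6) by (simp add: field_simps abs_mult abs_minus_commute)
    also have "\<dots> \<le> D * norm (x - y) / lam0\<^sup>2"
      using assms(3-6) DN unfolding power2_eq_square by (intro frac_le mult_mono) auto
    finally show ?thesis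
      unfolding norm_scaleR using assms(2) K DN by (intro mult_mono) auto
  qed
  moreover have "(1 / lam x) *\<^sub>R F x - (1 / lam y) *\<^sub>R F y
     = (1 / lam x) *\<^sub>R (F x - F y) + (1 / lam x - 1 / lam y) *\<^sub>R F y"
    by (simp add: algebra_simps)
  ultimately show ?thesis
    using norm_triangle_mono[of "(1 / lam x) *\<^sub>R (F x - F y)" _ "(1 / lam x - 1 / lam y) *\<^sub>R F y"]
    by (simp add: algebra_simps)
qed

lemma continuous_on_Icc_norm_bound:
  fixes f :: "real \<Rightarrow> 'a::real_normed_vector"
  assumes "continuous_on {a..b} f"
  obtains B where "\<And>t. t \<in> {a..b} \<Longrightarrow> norm (f t) \<le> B"
proof -
  have "bounded (f ` {a..b})"
    using assms by (intro compact_imp_bounded compact_continuous_image) auto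
  then obtain B where "\<forall>y\<in>f ` {a..b}. norm y \<le> B" by (auto simp: bounded_iff)
  then show thesis by (intro that[of B]) blast
qed

section \<open>Measurability of the two solutions\<close>

lemma first_order_solution_measurable:
  fixes b :: "real ^ 'd \<Rightarrow> real ^ 'd" and \<sigma> :: "real ^ 'd \<Rightarrow> real ^ 'd ^ 'd"
  assumes "C1_bounded_derivative b" "bounded (range b)"
    and "C1_bounded_derivative \<sigma>" "bounded (range \<sigma>)"
    and "C1_bounded_derivative lam" and "0 < lam_min" and lam: "\<And>x. lam_min \<le> lam x"
    and meas: "\<And>t. 0 \<le> t \<Longrightarrow> \<xi> t \<in> borel_measurable M"
    and cont: "\<And>\<omega> T. \<omega> \<in> space M \<Longrightarrow> continuous_on {0..T} (\<lambda>t. \<xi> t \<omega>)"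
    and sol: "\<And>\<omega>. \<omega> \<in> space M \<Longrightarrow> first_order_solution b lam \<sigma> (\<lambda>t. \<xi> t \<omega>) q0 (\<lambda>t. x t \<omega>)"
    and "0 \<le> T"
  shows "x T \<in> borel_measurable M"
proof -
  have cb: "continuous_on UNIV b" "continuous_on UNIV \<sigma>" "continuous_on UNIV lam"
    using assms(1,3,5) by (auto intro: C1_bounded_derivative_continuous)
  have lpos: "lam z > 0" for z using lam[of z] \<open>0 < lam_min\<close> by linarith
  let ?h = "\<lambda>e y. (1 / lam y) *\<^sub>R (b y + \<sigma> y *v e)"
  \<comment> \<open>Joint continuity in noise and state serves twice: for measurability after
    inserting measurable functions of \<omega>, and for continuity in time along the
    solution.\<close>
  have ch: "continuous_on UNIV (\<lambda>p. ?h (fst p) (snd p))"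
    using lpos
    by (intro continuous_intros bounded_bilinear.continuous_on[OF matrix_vector_mult_bounded_bilinear]
        continuous_on_compose2[OF cb(1)] continuous_on_compose2[OF cb(2)] continuous_on_compose2[OF cb(3)])
      (auto simp: less_imp_neq[THEN not_sym])
  have der: "((\<lambda>t. x t \<omega>) has_vector_derivative ?h (\<xi> t \<omega>) (x t \<omega>)) (at t within {0..T})"
    if "\<omega> \<in> space M" "t \<in> {0..T}" for t \<omega>
  proof -
    have "((\<lambda>t. x t \<omega>) has_vector_derivative ?h (\<xi> t \<omega>) (x t \<omega>)) (at t within {0..})"
      using sol[OF that(1)] that(2)
      by (auto simp: first_order_solution_def scaleR_add_right scaleR_matrix_vector_assoc)
    then show ?thesis by (rule has_vector_derivative_within_subset) auto
  qed
  show ?thesis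
  proof (rule ode_solution_measurable[OF \<open>0 \<le> T\<close>, where H = "\<lambda>t \<omega>. ?h (\<xi> t \<omega>)" and ?z0.0 = q0])
    show "(\<lambda>\<omega>. ?h (\<xi> t \<omega>) (y \<omega>)) \<in> borel_measurable M"
      if "t \<in> {0..T}" "y \<in> borel_measurable M" for t y
      using borel_measurable_continuous_Pair[OF meas that(2) ch, of t] that(1) by simp
    fix \<omega> assume \<omega>: "\<omega> \<in> space M"
    show "x 0 \<omega> = q0" using sol[OF \<omega>] by (simp add: first_order_solution_def)
    have "continuous_on {0..T} (\<lambda>t. x t \<omega>)"
      using der[OF \<omega>] by (rule continuous_on_vector_derivative)
    then have "continuous_on {0..T} (\<lambda>t. (\<xi> t \<omega>, x t \<omega>))"
      by (intro continuous_intros cont \<omega>)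
    from continuous_on_compose2[OF ch this]
    show "continuous_on {0..T} (\<lambda>t. ?h (\<xi> t \<omega>) (x t \<omega>))" by simp
    obtain X where X: "\<And>t. t \<in> {0..T} \<Longrightarrow> norm (\<xi> t \<omega>) \<le> X"
      using continuous_on_Icc_norm_bound[OF cont[OF \<omega>]] by blast
    obtain K L where KL: "\<And>e x. norm e \<le> X \<Longrightarrow> norm (b x + \<sigma> x *v e) \<le> K"
      "\<And>e x y. norm e \<le> X \<Longrightarrow> norm (b x + \<sigma> x *v e - (b y + \<sigma> y *v e)) \<le> L * norm (x - y)"
      using forced_drift_bounds[OF assms(1-4), of X] by metis
    obtain D where D: "\<And>x y. norm (lam x - lam y) \<le> D * norm (x - y)"
      using C1_bounded_derivative_lipschitz[OF assms(5)] by blast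
    show "\<exists>L. \<forall>t\<in>{0..T}. \<forall>y. norm (?h (\<xi> t \<omega>) y - ?h (\<xi> t \<omega>) (x t \<omega>)) \<le> L * norm (y - x t \<omega>)"
    proof (intro exI ballI allI)
      fix t y assume "t \<in> {0..T}"
      then show "norm (?h (\<xi> t \<omega>) y - ?h (\<xi> t \<omega>) (x t \<omega>))
          \<le> (L / lam_min + D * K / lam_min\<^sup>2) * norm (y - x t \<omega>)"
        using D \<open>0 < lam_min\<close> lam
        by (intro lipschitz_divide_scalar[where F = "\<lambda>y. b y + \<sigma> y *v \<xi> t \<omega>"] KL X) auto
    qed
  qed (use der in auto)
qed

text \<open>The position alone satisfies no first-order equation, so the Euler argument is applied
  to the pair of position and velocity, and the position is then projected out.\<close>

lemma second_order_solution_measurable: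
  fixes b :: "real ^ 'd \<Rightarrow> real ^ 'd" and \<sigma> :: "real ^ 'd \<Rightarrow> real ^ 'd ^ 'd"
  assumes "C1_bounded_derivative b" "bounded (range b)"
    and "C1_bounded_derivative \<sigma>" "bounded (range \<sigma>)"
    and "C1_bounded_derivative lam" and lam: "\<And>x. \<bar>lam x\<bar> \<le> lam_max"
    and "\<mu> > 0"
    and meas: "\<And>t. 0 \<le> t \<Longrightarrow> \<xi> t \<in> borel_measurable M"
    and cont: "\<And>\<omega> T. \<omega> \<in> space M \<Longrightarrow> continuous_on {0..T} (\<lambda>t. \<xi> t \<omega>)"
    and sol: "\<And>\<omega>. \<omega> \<in> space M \<Longrightarrow>
      second_order_solution b lam \<sigma> \<mu> (\<lambda>t. \<xi> t \<omega>) q0 p0 (\<lambda>t. x t \<omega>)"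
    and "0 \<le> T"
  shows "x T \<in> borel_measurable M"
proof -
  have cb: "continuous_on UNIV b" "continuous_on UNIV \<sigma>" "continuous_on UNIV lam"
    using assms(1,3,5) by (auto intro: C1_bounded_derivative_continuous)
  let ?F = "\<lambda>e y. b y + \<sigma> y *v e"
  let ?h = "\<lambda>e p. (snd p, (1 / \<mu>) *\<^sub>R (?F e (fst p) - lam (fst p) *\<^sub>R snd p))"
  have ch: "continuous_on UNIV (\<lambda>p. ?h (fst p) (snd p))"
    by (intro continuous_intros bounded_bilinear.continuous_on[OF matrix_vector_mult_bounded_bilinear]
        continuous_on_compose2[OF cb(1)] continuous_on_compose2[OF cb(2)] continuous_on_compose2[OF cb(3)])
      auto
  have "\<forall>\<omega>\<in>space M. \<exists>v. x 0 \<omega> = q0 \<and> v 0 = p0 \<and>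
      (\<forall>t\<ge>0. ((\<lambda>t. x t \<omega>) has_vector_derivative v t) (at t within {0..}) \<and>
        (v has_vector_derivative (1 / \<mu>) *\<^sub>R (?F (\<xi> t \<omega>) (x t \<omega>) - lam (x t \<omega>) *\<^sub>R v t)) (at t within {0..}))"
  proof
    fix \<omega> assume "\<omega> \<in> space M"
    then obtain v a where va: "x 0 \<omega> = q0" "v 0 = p0"
      "\<And>t. t \<ge> 0 \<Longrightarrow> ((\<lambda>t. x t \<omega>) has_vector_derivative v t) (at t within {0..})"
      "\<And>t. t \<ge> 0 \<Longrightarrow> (v has_vector_derivative a t) (at t within {0..})"
      "\<And>t. t \<ge> 0 \<Longrightarrow> \<mu> *\<^sub>R a t = b (x t \<omega>) - lam (x t \<omega>) *\<^sub>R v t + \<sigma> (x t \<omega>) *v \<xi> t \<omega>"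
      using sol unfolding second_order_solution_def by metis
    have "a t = (1 / \<mu>) *\<^sub>R (?F (\<xi> t \<omega>) (x t \<omega>) - lam (x t \<omega>) *\<^sub>R v t)" if "t \<ge> 0" for t
    proof -
      have "a t = (1 / \<mu>) *\<^sub>R (\<mu> *\<^sub>R a t)" using \<open>\<mu> > 0\<close> by simp
      also have "\<dots> = (1 / \<mu>) *\<^sub>R (?F (\<xi> t \<omega>) (x t \<omega>) - lam (x t \<omega>) *\<^sub>R v t)"
        unfolding va(5)[OF that] by (simp add: algebra_simps)
      finally show ?thesis .
    qed
    with va show "\<exists>v. x 0 \<omega> = q0 \<and> v 0 = p0 \<and>
      (\<forall>t\<ge>0. ((\<lambda>t. x t \<omega>) has_vector_derivative v t) (at t within {0..}) \<and>
        (v has_vector_derivative (1 / \<mu>) *\<^sub>R (?F (\<xi> t \<omega>) (x t \<omega>) - lam (x t \<omega>) *\<^sub>R v t)) (at t within {0..}))"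
      by (intro exI[of _ v]) auto
  qed
  \<comment> \<open>The velocities are chosen for each \<omega> separately and need not be known to
    be measurable: measurability of the pair is the outcome of the Euler limit.\<close>
  from bchoice[OF this] obtain v where v: "\<And>\<omega>. \<omega> \<in> space M \<Longrightarrow> x 0 \<omega> = q0 \<and> v \<omega> 0 = p0 \<and>
      (\<forall>t\<ge>0. ((\<lambda>t. x t \<omega>) has_vector_derivative v \<omega> t) (at t within {0..}) \<and>
        (v \<omega> has_vector_derivative (1 / \<mu>) *\<^sub>R (?F (\<xi> t \<omega>) (x t \<omega>) - lam (x t \<omega>) *\<^sub>R v \<omega> t)) (at t within {0..}))"
    by blast
  let ?z = "\<lambda>t \<omega>. (x t \<omega>, v \<omega> t)"
  have der: "((\<lambda>t. ?z t \<omega>) has_vector_derivative ?h (\<xi> t \<omega>) (?z t \<omega>)) (at t within {0..T})"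
    if "\<omega> \<in> space M" "t \<in> {0..T}" for t \<omega>
  proof -
    have "((\<lambda>t. ?z t \<omega>) has_vector_derivative ?h (\<xi> t \<omega>) (?z t \<omega>)) (at t within {0..})"
      using v[OF that(1)] that(2) by (auto intro!: has_vector_derivative_Pair)
    then show ?thesis by (rule has_vector_derivative_within_subset) auto
  qed
  have "?z T \<in> borel_measurable M"
  proof (rule ode_solution_measurable[OF \<open>0 \<le> T\<close>, where H = "\<lambda>t \<omega>. ?h (\<xi> t \<omega>)" and z = ?z and ?z0.0 = "(q0, p0)"])
    show "(\<lambda>\<omega>. ?h (\<xi> t \<omega>) (y \<omega>)) \<in> borel_measurable M"
      if "t \<in> {0..T}" "y \<in> borel_measurable M" for t and y :: "'a \<Rightarrow> (real ^ 'd) \<times> (real ^ 'd)"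
      using borel_measurable_continuous_Pair[OF meas that(2) ch, of t] that(1) by simp
    fix \<omega> assume \<omega>: "\<omega> \<in> space M"
    show "?z 0 \<omega> = (q0, p0)" using v[OF \<omega>] by simp
    have cz: "continuous_on {0..T} (\<lambda>t. ?z t \<omega>)"
      using der[OF \<omega>] by (rule continuous_on_vector_derivative)
    then have "continuous_on {0..T} (\<lambda>t. (\<xi> t \<omega>, ?z t \<omega>))"
      by (rule continuous_on_Pair[OF cont[OF \<omega>]])
    from continuous_on_compose2[OF ch this]
    show "continuous_on {0..T} (\<lambda>t. ?h (\<xi> t \<omega>) (?z t \<omega>))" by simp
    obtain X where X: "\<And>t. t \<in> {0..T} \<Longrightarrow> norm (\<xi> t \<omega>) \<le> X"
      using continuous_on_Icc_norm_bound[OF cont[OF \<omega>]] by blast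
    obtain V where V: "\<And>t. t \<in> {0..T} \<Longrightarrow> norm (v \<omega> t) \<le> V"
      using continuous_on_Icc_norm_bound[OF continuous_on_snd[OF cz]] by auto
    obtain K L where KL: "0 \<le> L" "\<And>e x. norm e \<le> X \<Longrightarrow> norm (b x + \<sigma> x *v e) \<le> K"
      "\<And>e x y. norm e \<le> X \<Longrightarrow> norm (b x + \<sigma> x *v e - (b y + \<sigma> y *v e)) \<le> L * norm (x - y)"
      using forced_drift_bounds[OF assms(1-4), of X] by metis
    obtain D where D: "0 \<le> D" "\<And>x y. norm (lam x - lam y) \<le> D * norm (x - y)"
      using C1_bounded_derivative_lipschitz[OF assms(5)] by blast
    have lm: "0 \<le> lam_max" using lam[of undefined] by linarith
    show "\<exists>L. \<forall>t\<in>{0..T}. \<forall>y. norm (?h (\<xi> t \<omega>) y - ?h (\<xi> t \<omega>) (?z t \<omega>)) \<le> L * norm (y - ?z t \<omega>)"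
    proof (intro exI ballI allI)
      fix t and y :: "(real ^ 'd) \<times> (real ^ 'd)" assume t: "t \<in> {0..T}"
      obtain y1 y2 where y: "y = (y1, y2)" by (cases y)
      let ?N = "norm (y - ?z t \<omega>)" and ?F' = "?F (\<xi> t \<omega>)"
      have V0: "0 \<le> V" using V[OF t] norm_ge_zero order_trans by blast
      have N1: "norm (y1 - x t \<omega>) \<le> ?N" and N2: "norm (y2 - v \<omega> t) \<le> ?N"
        using norm_fst_le[of "y1 - x t \<omega>" "y2 - v \<omega> t"]
          norm_snd_le[where x = "y1 - x t \<omega>" and y = "y2 - v \<omega> t"] by (auto simp: y)
      have 1: "norm (?F' y1 - ?F' (x t \<omega>)) \<le> L * ?N"
        using order_trans[OF KL(3)[OF X[OF t]] mult_left_mono[OF N1 KL(1)]] .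
      have 2: "norm (lam y1 *\<^sub>R (y2 - v \<omega> t)) \<le> lam_max * ?N"
        using lam N2 lm by (auto intro!: mult_mono)
      have "norm (lam y1 - lam (x t \<omega>)) \<le> D * ?N"
        using order_trans[OF D(2) mult_left_mono[OF N1 D(1)]] .
      then have 3: "norm ((lam y1 - lam (x t \<omega>)) *\<^sub>R v \<omega> t) \<le> D * ?N * V"
        using V[OF t] V0 D(1) by (auto intro!: mult_mono)
      \<comment> \<open>The friction difference is split so that the increment of \<open>lam\<close>
        multiplies the trajectory's velocity, bounded by \<open>V\<close>, and not the arbitrary
        \<open>y2\<close>; the remaining part uses the bound \<open>lam_max\<close>.\<close>
      have eq: "?F' y1 - lam y1 *\<^sub>R y2 - (?F' (x t \<omega>) - lam (x t \<omega>) *\<^sub>R v \<omega> t)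
        = (?F' y1 - ?F' (x t \<omega>)) - (lam y1 *\<^sub>R (y2 - v \<omega> t) + (lam y1 - lam (x t \<omega>)) *\<^sub>R v \<omega> t)"
        by (simp add: algebra_simps)
      have 4: "norm (?F' y1 - lam y1 *\<^sub>R y2 - (?F' (x t \<omega>) - lam (x t \<omega>) *\<^sub>R v \<omega> t))
        \<le> L * ?N + (lam_max * ?N + D * ?N * V)"
        unfolding eq
        by (rule order_trans[OF norm_triangle_ineq4 add_mono[OF 1 norm_triangle_mono[OF 2 3]]])
      have "?h (\<xi> t \<omega>) y - ?h (\<xi> t \<omega>) (?z t \<omega>)
        = (y2 - v \<omega> t, (1 / \<mu>) *\<^sub>R (?F' y1 - lam y1 *\<^sub>R y2 - (?F' (x t \<omega>) - lam (x t \<omega>) *\<^sub>R v \<omega> t)))"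
        by (simp add: y scaleR_diff_right)
      then have "norm (?h (\<xi> t \<omega>) y - ?h (\<xi> t \<omega>) (?z t \<omega>)) \<le> norm (y2 - v \<omega> t)
        + norm ((1 / \<mu>) *\<^sub>R (?F' y1 - lam y1 *\<^sub>R y2 - (?F' (x t \<omega>) - lam (x t \<omega>) *\<^sub>R v \<omega> t)))"
        using norm_Pair_le by metis
      also have "\<dots> \<le> ?N + (1 / \<mu>) * (L * ?N + (lam_max * ?N + D * ?N * V))"
        unfolding norm_scaleR using N2 mult_left_mono[OF 4, of "1 / \<mu>"] \<open>\<mu> > 0\<close> by simp
      also have "\<dots> = (1 + (1 / \<mu>) * (L + (lam_max + D * V))) * ?N" by (simp add: algebra_simps)
      finally show "norm (?h (\<xi> t \<omega>) y - ?h (\<xi> t \<omega>) (?z t \<omega>))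
        \<le> (1 + (1 / \<mu>) * (L + (lam_max + D * V))) * ?N" .
    qed
  qed (use der in auto)
  then have "(\<lambda>\<omega>. fst (?z T \<omega>)) \<in> borel_measurable M"
    by (rule measurable_compose) (auto intro!: borel_measurable_continuous_onI continuous_intros)
  then show ?thesis by simp
qed

section \<open>Pathwise convergence and the theorem\<close>

lemma second_order_solution_converges:
  fixes b :: "real ^ 'd \<Rightarrow> real ^ 'd" and \<sigma> :: "real ^ 'd \<Rightarrow> real ^ 'd ^ 'd"
  assumes "C1_bounded_derivative b" "bounded (range b)"
    and "C1_bounded_derivative \<sigma>" "bounded (range \<sigma>)"
    and "C1_bounded_derivative lam" and "0 < lam_min" and lam: "\<And>x. lam_min \<le> lam x"
    and cont: "continuous_on {0..T} \<xi>"
    and y: "first_order_solution b lam \<sigma> \<xi> q0 y"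
    and x: "\<And>\<mu>. \<mu> > 0 \<Longrightarrow> second_order_solution b lam \<sigma> \<mu> \<xi> q0 p0 (x \<mu>)"
  obtains C where "\<And>\<mu> t. \<mu> > 0 \<Longrightarrow> t \<in> {0..T} \<Longrightarrow> norm (x \<mu> t - y t) \<le> \<mu> * C"
proof -
  obtain lam' where lam': "\<And>x. (lam has_derivative blinfun_apply (lam' x)) (at x)"
    and bd: "bounded (range lam')"
    using assms(5) unfolding C1_bounded_derivative_def by blast
  obtain D' where D': "\<And>x. norm (lam' x) \<le> D'"
    using bd by (auto simp: bounded_iff)
  obtain X where X: "\<And>t. t \<in> {0..T} \<Longrightarrow> norm (\<xi> t) \<le> X"
    using continuous_on_Icc_norm_bound[OF cont] by blast
  obtain K L where KL: "0 \<le> L" "\<And>e x. norm e \<le> X \<Longrightarrow> norm (b x + \<sigma> x *v e) \<le> K"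
    "\<And>e x y. norm e \<le> X \<Longrightarrow> norm (b x + \<sigma> x *v e - (b y + \<sigma> y *v e)) \<le> L * norm (x - y)"
    using forced_drift_bounds[OF assms(1-4), of X] by metis
  obtain D where D: "0 \<le> D" "\<And>x y. norm (lam x - lam y) \<le> D * norm (x - y)"
    using C1_bounded_derivative_lipschitz[OF assms(5)] by blast
  \<comment> \<open>\<open>max K 0\<close> guarantees the nonnegative Lipschitz constant that
    \<open>small_mass_rate\<close> requires.\<close>
  have K: "norm (b z + \<sigma> z *v \<xi> t) \<le> max K 0" if "t \<in> {0..T}" for t z
    using KL(2)[OF X[OF that], of z] by simp
  obtain C where C: "\<And>\<mu> x v a t. 0 < \<mu> \<Longrightarrow>
      (\<And>t. t \<in> {0..T} \<Longrightarrow> (x has_vector_derivative v t) (at t within {0..T})) \<Longrightarrow>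
      (\<And>t. t \<in> {0..T} \<Longrightarrow> (v has_vector_derivative a t) (at t within {0..T})) \<Longrightarrow>
      (\<And>t. t \<in> {0..T} \<Longrightarrow> \<mu> *\<^sub>R a t = (b (x t) + \<sigma> (x t) *v \<xi> t) - lam (x t) *\<^sub>R v t) \<Longrightarrow>
      x 0 = y 0 \<Longrightarrow> v 0 = p0 \<Longrightarrow> t \<in> {0..T} \<Longrightarrow> norm (x t - y t) \<le> \<mu> * C"
  proof (rule small_mass_rate[of lam lam' D' lam_min T "\<lambda>t z. b z + \<sigma> z *v \<xi> t" "max K 0"
        "L / lam_min + D * max K 0 / lam_min\<^sup>2" y p0])
    show "0 \<le> L / lam_min + D * max K 0 / lam_min\<^sup>2" using KL(1) D(1) \<open>0 < lam_min\<close> by simp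
    fix t assume t: "t \<in> {0..T}"
    show "norm ((1 / lam z) *\<^sub>R (b z + \<sigma> z *v \<xi> t) - (1 / lam z') *\<^sub>R (b z' + \<sigma> z' *v \<xi> t))
      \<le> (L / lam_min + D * max K 0 / lam_min\<^sup>2) * norm (z - z')" for z z'
      using D(2) \<open>0 < lam_min\<close> lam
      by (intro lipschitz_divide_scalar[where F = "\<lambda>y. b y + \<sigma> y *v \<xi> t"] KL(3) K X t) auto
    have "(y has_vector_derivative (1 / lam (y t)) *\<^sub>R (b (y t) + \<sigma> (y t) *v \<xi> t)) (at t within {0..})"
      using y t by (auto simp: first_order_solution_def scaleR_add_right scaleR_matrix_vector_assoc)
    then show "(y has_vector_derivative (1 / lam (y t)) *\<^sub>R (b (y t) + \<sigma> (y t) *v \<xi> t)) (at t within {0..T})"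
      by (rule has_vector_derivative_within_subset) auto
  qed (use lam' D' \<open>0 < lam_min\<close> lam K in auto)
  show thesis
  proof (rule that)
    fix \<mu> t :: real assume \<mu>: "\<mu> > 0" and t: "t \<in> {0..T}"
    obtain v a where va: "x \<mu> 0 = q0" "v 0 = p0"
      "\<And>t. t \<ge> 0 \<Longrightarrow> (x \<mu> has_vector_derivative v t) (at t within {0..})"
      "\<And>t. t \<ge> 0 \<Longrightarrow> (v has_vector_derivative a t) (at t within {0..})"
      "\<And>t. t \<ge> 0 \<Longrightarrow> \<mu> *\<^sub>R a t = b (x \<mu> t) - lam (x \<mu> t) *\<^sub>R v t + \<sigma> (x \<mu> t) *v \<xi> t"
      using x[OF \<mu>] unfolding second_order_solution_def by metis
    show "norm (x \<mu> t - y t) \<le> \<mu> * C"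
    proof (rule C[where x = "x \<mu>" and v = v and a = a, OF \<mu>])
      show "x \<mu> 0 = y 0" using va(1) y by (simp add: first_order_solution_def)
      fix s assume s: "s \<in> {0..T}"
      show "(x \<mu> has_vector_derivative v s) (at s within {0..T})"
        using va(3)[of s] s by (auto intro: has_vector_derivative_within_subset)
      show "(v has_vector_derivative a s) (at s within {0..T})"
        using va(4)[of s] s by (auto intro: has_vector_derivative_within_subset)
      show "\<mu> *\<^sub>R a s = (b (x \<mu> s) + \<sigma> (x \<mu> s) *v \<xi> s) - lam (x \<mu> s) *\<^sub>R v s"
        using va(5)[of s] s by simp
    qed (use va(2) t in auto)
  qed
qed

theorem mainTheorem2:
  fixes M :: "'w measure"
    and W :: "real \<Rightarrow> 'w \<Rightarrow> real ^ 'd"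
    and b :: "real ^ 'd \<Rightarrow> real ^ 'd"
    and \<sigma> :: "real ^ 'd \<Rightarrow> real ^ 'd ^ 'd"
    and lam :: "real ^ 'd \<Rightarrow> real"
    and \<rho> :: "real \<Rightarrow> real"
    and q0 p0 :: "real ^ 'd"
    and q :: "real \<Rightarrow> real \<Rightarrow> 'w \<Rightarrow> real ^ 'd"
    and q_lim :: "real \<Rightarrow> 'w \<Rightarrow> real ^ 'd"
    and lam_min lam_max \<delta> \<kappa> T :: real
  assumes "C1_bounded_derivative b" and "bounded (range b)"
    and "C1_bounded_derivative \<sigma>" and "bounded (range \<sigma>)"
    and "\<And>x. invertible (\<sigma> x ** transpose (\<sigma> x))"
    and "C1_bounded_derivative lam"
    and "0 < lam_min" and "\<And>x. lam_min \<le> lam x" and "\<And>x. lam x \<le> lam_max"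
    and "wiener_process M W"
    and "mollifier \<rho>" and "\<delta> > 0"
    and "\<And>\<mu> \<omega>. \<mu> > 0 \<Longrightarrow> \<omega> \<in> space M \<Longrightarrow>
           second_order_solution b lam \<sigma> \<mu> (mollified_noise \<rho> \<delta> (\<lambda>t. W t \<omega>)) q0 p0
             (\<lambda>t. q \<mu> t \<omega>)"
    and "\<And>\<omega>. \<omega> \<in> space M \<Longrightarrow>
           first_order_solution b lam \<sigma> (mollified_noise \<rho> \<delta> (\<lambda>t. W t \<omega>)) q0
             (\<lambda>t. q_lim t \<omega>)"
    and "\<kappa> > 0" and "T > 0"
  shows "(\<forall>\<mu>>0. {\<omega> \<in> space M. (SUP t\<in>{0..T}. norm (q \<mu> t \<omega> - q_lim t \<omega>)) > \<kappa>} \<in> sets M) \<and>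
    ((\<lambda>\<mu>. measure M {\<omega> \<in> space M. (SUP t\<in>{0..T}. norm (q \<mu> t \<omega> - q_lim t \<omega>)) > \<kappa>})
       \<longlongrightarrow> 0) (at_right 0)"
proof -
  let ?\<xi> = "\<lambda>t \<omega>. mollified_noise \<rho> \<delta> (\<lambda>t. W t \<omega>) t"
  let ?A = "\<lambda>\<mu>. {\<omega> \<in> space M. (SUP t\<in>{0..T}. norm (q \<mu> t \<omega> - q_lim t \<omega>)) > \<kappa>}"
  interpret prob_space M using assms(10) by (simp add: wiener_process_def)
  have W: "\<And>t. 0 \<le> t \<Longrightarrow> W t \<in> borel_measurable M"
    and Wc: "\<And>\<omega>. \<omega> \<in> space M \<Longrightarrow> continuous_on {0..} (\<lambda>t. W t \<omega>)"
    using assms(10) by (auto simp: wiener_process_def)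
  have \<xi>m: "\<And>t. 0 \<le> t \<Longrightarrow> ?\<xi> t \<in> borel_measurable M"
    using borel_measurable_mollified_noise[OF assms(11,12) _ W Wc] .
  have \<xi>c: "continuous_on {0..S} (\<lambda>t. ?\<xi> t \<omega>)" if "\<omega> \<in> space M" for \<omega> S
    by (rule continuous_on_mollified_noise[OF assms(11,12) Wc[OF that]])
  have lmax: "\<bar>lam x\<bar> \<le> lam_max" for x using assms(7) assms(8)[of x] assms(9)[of x] by linarith
  have qm: "q \<mu> t \<in> borel_measurable M" if "\<mu> > 0" "t \<ge> 0" for \<mu> t
    by (rule second_order_solution_measurable[OF assms(1-4,6) lmax that(1) \<xi>m \<xi>c assms(13)[OF that(1)] that(2)])
  have lm: "q_lim t \<in> borel_measurable M" if "t \<ge> 0" for t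
    by (rule first_order_solution_measurable[OF assms(1-4,6-8) \<xi>m \<xi>c assms(14) that])
  have qc: "continuous_on {0..T} (\<lambda>t. q \<mu> t \<omega>)" if "\<mu> > 0" "\<omega> \<in> space M" for \<mu> \<omega>
  proof -
    have "continuous_on {0..} (\<lambda>t. q \<mu> t \<omega>)"
      using assms(13)[OF that] unfolding second_order_solution_def
      by (auto intro: continuous_on_vector_derivative)
    then show ?thesis by (rule continuous_on_subset) auto
  qed
  have lc: "continuous_on {0..T} (\<lambda>t. q_lim t \<omega>)" if "\<omega> \<in> space M" for \<omega>
  proof -
    have "continuous_on {0..} (\<lambda>t. q_lim t \<omega>)"
      using assms(14)[OF that] unfolding first_order_solution_def
      by (auto intro: continuous_on_vector_derivative)
    then show ?thesis by (rule continuous_on_subset) auto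
  qed
  have A: "?A \<mu> \<in> sets M" if "\<mu> > 0" for \<mu>
    by (rule SUP_greater_measurable)
      (use assms(16) qm lm qc lc that in \<open>auto intro!: borel_measurable_norm borel_measurable_diff continuous_intros\<close>)
  have "((\<lambda>\<mu>. prob (?A \<mu>)) \<longlongrightarrow> 0) (at_right 0)"
  proof (rule prob_tendsto_0_at_right[OF A])
    fix \<omega> assume \<omega>: "\<omega> \<in> space M"
    \<comment> \<open>\<open>C\<close> depends on \<omega> through the noise, but not on \<mu> or on
      the time. Passing to the limit in \<open>\<mu> * C\<close>, rather than using a threshold
      \<open>\<kappa> / C\<close>, needs no sign condition on \<open>C\<close>.\<close>
    obtain C where C: "\<And>\<mu> t. \<mu> > 0 \<Longrightarrow> t \<in> {0..T} \<Longrightarrow> norm (q \<mu> t \<omega> - q_lim t \<omega>) \<le> \<mu> * C"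
      using second_order_solution_converges[OF assms(1-4,6-8) \<xi>c[OF \<omega>] assms(14)[OF \<omega>],
        of p0 "\<lambda>\<mu> t. q \<mu> t \<omega>" T] assms(13)[OF _ \<omega>] by metis
    have "((\<lambda>\<mu>. \<mu> * C) \<longlongrightarrow> 0 * C) (at_right 0)" by (intro tendsto_intros)
    then have "eventually (\<lambda>\<mu>. \<mu> * C < \<kappa>) (at_right 0)"
      using assms(15) by (auto dest: order_tendstoD(2))
    moreover have "eventually (\<lambda>\<mu>::real. \<mu> > 0) (at_right 0)" by (rule eventually_at_right_less)
    ultimately show "eventually (\<lambda>\<mu>. \<omega> \<notin> ?A \<mu>) (at_right 0)"
    proof eventually_elim
      case (elim \<mu>)
      have "(SUP t\<in>{0..T}. norm (q \<mu> t \<omega> - q_lim t \<omega>)) \<le> \<mu> * C"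
        using assms(16) C[OF elim(2)] by (intro cSUP_least) auto
      with elim(1) show ?case by simp
    qed
  qed
  with A show ?thesis by blast
qed

end
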